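(* Let $n$ be a positive integer. Every graph $G\in\overline G_{n,n}$ is pancyclic.
   Context: All graphs are finite and simple. For a positive integer $n$, $G_{n,n}$ denotes the class of all simple graphs that have the same degree sequence as the disjoint union $K_n\cup K_n$ of two cliques but are not isomorphic to $K_n\cup K_n$. $\overline G_{n,n}$ denotes the class of complements of graphs in $G_{n,n}$; equivalently, the $n$-regular graphs on $2n$ vertices that are not isomorphic to the complete bipartite graph $K_{n,n}$. A graph on $N$ vertices is pancyclic if it contains cycles of every length from $3$ to $N$. *)

theory Defs
  imports "Graph_Theory.Graph_Theory" "HOL-Library.Multiset"
begin

text \<open>
  A finite simple graph is a \<^locale>\<open>pair_graph\<close>: a finite, loop-free, symmetric
  set of ordered pairs, in which an edge between u and v is the two arcs (u, v) and (v, u).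
  The number of neighbours of a vertex is therefore its \<^const>\<open>out_degree\<close>.
\<close>

definition complete_graph :: "'a set \<Rightarrow> 'a pair_pre_digraph" where
  "complete_graph V = \<lparr> pverts = V, parcs = {(u, v). u \<in> V \<and> v \<in> V \<and> u \<noteq> v} \<rparr>"

definition graph_disjoint_union ::
    "'a pair_pre_digraph \<Rightarrow> 'b pair_pre_digraph \<Rightarrow> ('a + 'b) pair_pre_digraph" where
  "graph_disjoint_union G H =
     \<lparr> pverts = pverts G <+> pverts H,
       parcs = map_prod Inl Inl ` parcs G \<union> map_prod Inr Inr ` parcs H \<rparr>"

definition graph_complement :: "'a pair_pre_digraph \<Rightarrow> 'a pair_pre_digraph" where
  "graph_complement G =
     \<lparr> pverts = pverts G,
       parcs = {(u, v). u \<in> pverts G \<and> v \<in> pverts G \<and> u \<noteq> v \<and> (u, v) \<notin> parcs G} \<rparr>"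

definition two_cliques :: "nat \<Rightarrow> (nat + nat) pair_pre_digraph" where
  "two_cliques n = graph_disjoint_union (complete_graph {..<n}) (complete_graph {..<n})"

text \<open>The degrees of all vertices, with repetitions, in nonincreasing order.\<close>

definition degree_sequence :: "'a pair_pre_digraph \<Rightarrow> nat list" where
  "degree_sequence G =
     rev (sorted_list_of_multiset
       (image_mset (out_degree (with_proj G)) (mset_set (pverts G))))"

definition two_cliques_class :: "nat \<Rightarrow> 'a pair_pre_digraph set" where
  "two_cliques_class n =
     {G. pair_graph G \<and> degree_sequence G = degree_sequence (two_cliques n) \<and>
         \<not> digraph_iso (with_proj G) (with_proj (two_cliques n))}"

definition co_two_cliques_class :: "nat \<Rightarrow> 'a pair_pre_digraph set" where
  "co_two_cliques_class n = graph_complement ` two_cliques_class n"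

text \<open>
  The library also counts the closed walk u, v, u as a cycle; since the length is
  at least 3 here, the directed cycles of a symmetric digraph are exactly the
  traversals of the cycles of the undirected graph.
\<close>

definition pancyclic :: "'a pair_pre_digraph \<Rightarrow> bool" where
  "pancyclic G \<longleftrightarrow>
     (\<forall>k \<in> {3..card (pverts G)}. \<exists>p. pre_digraph.cycle (with_proj G) p \<and> length p = k)"

lemma pair_graph_complete_graph: "finite V \<Longrightarrow> pair_graph (complete_graph V)"
  by unfold_locales
    (auto simp: complete_graph_def symmetric_def sym_def intro: finite_subset[of _ "V \<times> V"])

lemma pair_graph_graph_disjoint_union:
  assumes "pair_graph G" "pair_graph H"
  shows "pair_graph (graph_disjoint_union G H)"
proof -
  interpret G: pair_graph G by fact
  interpret H: pair_graph H by fact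
  have s: "sym (parcs G)" "sym (parcs H)"
    using G.pair_sym_arcs H.pair_sym_arcs by (auto simp: symmetric_def)
  show ?thesis
    by unfold_locales
      (use s G.pair_no_loops H.pair_no_loops in
        \<open>auto simp: graph_disjoint_union_def symmetric_def sym_def image_iff Bex_def split_paired_Ex
          G.pair_finite_verts H.pair_finite_verts G.pair_finite_arcs H.pair_finite_arcs
          intro: G.in_arcsD1 G.in_arcsD2 H.in_arcsD1 H.in_arcsD2\<close>)
qed

lemma pair_graph_graph_complement:
  assumes "pair_graph G"
  shows "pair_graph (graph_complement G)"
proof -
  interpret pair_graph G by fact
  have s: "sym (parcs G)"
    using pair_sym_arcs by (auto simp: symmetric_def)
  show ?thesis
    by unfold_locales
      (use s in \<open>auto simp: graph_complement_def symmetric_def sym_def pair_finite_verts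
         intro: finite_subset[of _ "pverts G \<times> pverts G"]\<close>)
qed

lemma pair_graph_two_cliques: "pair_graph (two_cliques n)"
  unfolding two_cliques_def
  by (intro pair_graph_graph_disjoint_union pair_graph_complete_graph) auto

end

theory Submission
  imports Defs
begin

text \<open>
  Let G be the complement of a graph with the degrees of two disjoint cliques of order n, so that
  G is n-regular on 2n vertices.  For n = 1 there are no lengths to consider, so let
  n \<ge> 2.  Every degree is half the order, hence G has a Hamiltonian cycle
  by Dirac's theorem (\<open>dirac\<close>).  The remaining lengths come from an attempt to
  shorten this cycle by a single vertex.

  If there is a cycle C through all vertices but one, say v, then v has n neighbours among the
  2n - 1 vertices of C.  Moving these n positions along C by k - 2 steps gives a set
  that must meet the original one, because n + n > 2n - 1.  So v has two neighbours that are
  k - 2 steps apart on C, and these close a cycle of length k through v, for every k from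
  3 to 2n (\<open>pancyclic_of_almost_hamiltonian\<close>).

  If there is no such cycle C, fix a Hamiltonian cycle x 0, ..., x (2n - 1).  The vertices x 0 and
  x 2 are not adjacent, as x 1 could be skipped; and x 0 x t, x 1 x (t + 2) are never both
  edges, as together they give a cycle that avoids only x (t + 1).  The degrees of x 0 and x 1 are
  so large that exactly one of these two is an edge for each t
  (\<open>hamiltonian_alternate\<close>).  This holds on every rotation of the cycle, so induction on the
  distance shows that two vertices are adjacent iff their distance along the cycle is odd
  (\<open>adj_nth_iff_odd\<close>).  Hence G is the complete bipartite graph between the even and
  the odd positions, and its complement consists of two cliques of order n, which is the excluded
  case.
\<close>

section \<open>Paths and cycles as lists of vertices\<close>

context pair_graph
begin

abbreviation adj :: "'a \<Rightarrow> 'a \<Rightarrow> bool" where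
  "adj u v \<equiv> (u, v) \<in> parcs G"

abbreviation nbrs :: "'a \<Rightarrow> 'a set" where
  "nbrs v \<equiv> parcs G `` {v}"

definition vpath :: "'a list \<Rightarrow> bool" where
  "vpath xs \<longleftrightarrow> xs \<noteq> [] \<and> set xs \<subseteq> pverts G \<and> distinct xs \<and> successively adj xs"

text \<open>
  Cyclic sequences of at least three distinct vertices; the closing edge joins the last vertex to
  the first one, which is not repeated, so that the length of the list is the length of the cycle.
\<close>

definition vcycle :: "'a list \<Rightarrow> bool" where
  "vcycle xs \<longleftrightarrow> 3 \<le> length xs \<and> vpath xs \<and> adj (last xs) (hd xs)"

lemma adj_commute: "adj u v \<longleftrightarrow> adj v u"
  by (auto intro: arcs_symmetric)

lemma nbrs_subset: "nbrs v \<subseteq> pverts G - {v}"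
  by (auto dest: in_arcsD2 no_loops')

lemma finite_nbrs: "finite (nbrs v)"
  using nbrs_subset pair_finite_verts by (rule finite_subset[OF _ finite_Diff])

lemma successively_adj_rev: "successively adj (rev xs) \<longleftrightarrow> successively adj xs"
  by (simp add: adj_commute)

lemma length_vpath_le: "vpath xs \<Longrightarrow> length xs \<le> card (pverts G)"
  unfolding vpath_def by (metis card_mono distinct_card pair_finite_verts)

text \<open>
  The arcs of the walk through a list of vertices are the pairs of consecutive entries.  A cycle
  is then obtained from the list with its first vertex appended.
\<close>

lemma awalk_of_successively:
  assumes "successively adj xs" "xs \<noteq> []" "set xs \<subseteq> pverts G"
  shows "awalk (hd xs) (zip xs (tl xs)) (last xs) \<and> pawalk_verts (hd xs) (zip xs (tl xs)) = xs"
  using assms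
proof (induction xs rule: induct_list012)
  case (3 x y zs)
  then show ?case by (auto simp: awalk_Cons_iff)
qed (auto simp: awalk_Nil_iff)

lemma cycle_of_vcycle:
  assumes "vcycle xs"
  shows "\<exists>p. cycle p \<and> length p = length xs"
proof -
  let ?ys = "xs @ [hd xs]"
  have ne: "xs \<noteq> []" using assms by (auto simp: vcycle_def)
  have "successively adj ?ys" "set ?ys \<subseteq> pverts G"
    using assms ne by (auto simp: vcycle_def vpath_def successively_append_iff)
  from awalk_of_successively[OF this(1) _ this(2)] ne
  have "awalk (hd xs) (zip ?ys (tl ?ys)) (hd xs)"
    "pawalk_verts (hd xs) (zip ?ys (tl ?ys)) = ?ys"
    by auto
  moreover have "distinct (tl ?ys)"
    using assms ne by (cases xs) (auto simp: vcycle_def vpath_def)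
  moreover have "zip ?ys (tl ?ys) \<noteq> []" "length (zip ?ys (tl ?ys)) = length xs"
    using ne by (cases xs; auto)+
  ultimately show ?thesis
    unfolding cycle_def by (intro exI[of _ "zip ?ys (tl ?ys)"]) auto
qed

lemma vcycle_rotate: "vcycle xs \<Longrightarrow> vcycle (rotate k xs)"
proof (induction k)
  case (Suc k)
  have "vcycle ys \<Longrightarrow> vcycle (rotate1 ys)" for ys
    by (cases ys)
      (auto simp: vcycle_def vpath_def successively_append_iff successively_Cons hd_append
        split: if_splits)
  with Suc show ?case by simp
qed simp

text \<open>
  All the degree arguments below are pigeonhole arguments on positions in a list, so
  degrees are counted in positions.
\<close>

lemma card_nbr_positions:
  assumes "distinct xs"
  shows "card {i. i < length xs \<and> adj v (xs ! i)} = card (nbrs v \<inter> set xs)"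
proof -
  have "inj_on ((!) xs) {i. i < length xs \<and> adj v (xs ! i)}"
    using assms by (auto intro!: inj_onI simp: nth_eq_iff_index_eq)
  then have "card ((!) xs ` {i. i < length xs \<and> adj v (xs ! i)}) =
      card {i. i < length xs \<and> adj v (xs ! i)}"
    by (rule card_image)
  moreover have "(!) xs ` {i. i < length xs \<and> adj v (xs ! i)} = nbrs v \<inter> set xs"
    by (auto simp: in_set_conv_nth)
  ultimately show ?thesis by simp
qed

section \<open>Hamiltonian cycles from large degrees\<close>

text \<open>
  The crossing argument in Dirac's theorem.  A path x 0, ..., x (L - 1) has L - 1 edges; by
  counting, for one of them, x i x (i + 1), the first vertex is adjacent to x (i + 1) and the
  last vertex to x i.  Replacing this edge by the two chords turns the path into a cycle.
\<close>

lemma vcycle_of_long_path: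
  assumes path: "vpath xs" and "3 \<le> length xs"
    and deg: "length xs \<le> card (nbrs (hd xs)) + card (nbrs (last xs))"
    and hd: "nbrs (hd xs) \<subseteq> set xs" and last: "nbrs (last xs) \<subseteq> set xs"
  obtains ys where "vcycle ys" "set ys = set xs" "length ys = length xs"
proof -
  let ?L = "length xs"
  define A where "A = {i. Suc i < ?L \<and> adj (hd xs) (xs ! Suc i)}"
  define B where "B = {i. Suc i < ?L \<and> adj (last xs) (xs ! i)}"
  have ne: "xs \<noteq> []" and dist: "distinct xs" using path by (auto simp: vpath_def)
  have "Suc ` A = {i. i < ?L \<and> adj (hd xs) (xs ! i)}"
  proof (intro equalityI subsetI)
    fix i assume i: "i \<in> {i. i < ?L \<and> adj (hd xs) (xs ! i)}"
    then have "i \<noteq> 0" using ne no_loops' by (metis hd_conv_nth mem_Collect_eq)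
    with i show "i \<in> Suc ` A" by (cases i) (auto simp: A_def)
  qed (auto simp: A_def)
  then have "card A = card {i. i < ?L \<and> adj (hd xs) (xs ! i)}"
    by (metis card_image inj_Suc)
  then have A: "card A = card (nbrs (hd xs))"
    using dist hd by (simp add: card_nbr_positions Int_absorb2)
  have "B = {i. i < ?L \<and> adj (last xs) (xs ! i)}"
  proof (intro equalityI subsetI)
    fix i assume i: "i \<in> {i. i < ?L \<and> adj (last xs) (xs ! i)}"
    then have "i \<noteq> ?L - 1" using ne no_loops' by (metis last_conv_nth mem_Collect_eq)
    with i show "i \<in> B" by (auto simp: B_def)
  qed (auto simp: B_def)
  then have B: "card B = card (nbrs (last xs))"
    using dist last by (simp add: card_nbr_positions Int_absorb2)
  have sub: "A \<subseteq> {..<?L - 1}" "B \<subseteq> {..<?L - 1}" by (auto simp: A_def B_def)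
  then have fin: "finite A" "finite B" by (auto intro: finite_subset)
  have "A \<inter> B \<noteq> {}"
  proof
    assume "A \<inter> B = {}"
    then have "card (A \<union> B) = card A + card B"
      using fin by (intro card_Un_disjoint)
    moreover have "card (A \<union> B) \<le> card {..<?L - 1}"
      using sub by (intro card_mono) auto
    ultimately show False using A B deg assms(2) by simp
  qed
  then obtain i where i: "Suc i < ?L" "adj (hd xs) (xs ! Suc i)" "adj (last xs) (xs ! i)"
    by (auto simp: A_def B_def)
  let ?P = "take (Suc i) xs" and ?Q = "drop (Suc i) xs"
  have xs: "xs = ?P @ ?Q" by simp
  have hl: "hd ?P = hd xs" "last ?P = xs ! i" "hd ?Q = xs ! Suc i" "last ?Q = last xs"
    using i(1) ne by (simp_all add: take_Suc_conv_app_nth hd_drop_conv_nth hd_conv_nth hd_append)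
  have s: "successively adj ?P" "successively adj ?Q"
    using path xs by (metis vpath_def successively_append_iff)+
  have "vcycle (?P @ rev ?Q)"
    unfolding vcycle_def vpath_def
  proof (intro conjI)
    show "3 \<le> length (?P @ rev ?Q)" "?P @ rev ?Q \<noteq> []" using assms(2) i by auto
    have "set (?P @ rev ?Q) = set xs" by (metis set_append set_rev xs)
    then show "set (?P @ rev ?Q) \<subseteq> pverts G" using path by (simp add: vpath_def)
    show "distinct (?P @ rev ?Q)" using dist xs by (metis distinct_append distinct_rev set_rev)
    show "successively adj (?P @ rev ?Q)"
      unfolding successively_append_iff successively_adj_rev
      using s i hl by (auto simp: hd_rev adj_commute)
    show "adj (last (?P @ rev ?Q)) (hd (?P @ rev ?Q))"
      using i hl ne by (auto simp: last_rev adj_commute)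
  qed
  moreover have "set (?P @ rev ?Q) = set xs" by (metis set_append set_rev xs)
  moreover have "length (?P @ rev ?Q) = length xs" by simp
  ultimately show ?thesis using that by blast
qed

text \<open>
  A longest path contains all neighbours of its ends, so its vertices form a cycle.  This cycle has
  more than half of the vertices, hence any vertex w outside it has a neighbour on it;
  opening the cycle at that neighbour and appending w would give a longer path.
\<close>

lemma dirac:
  assumes "3 \<le> card (pverts G)"
    and deg: "\<And>v. v \<in> pverts G \<Longrightarrow> card (pverts G) \<le> 2 * card (nbrs v)"
  obtains xs where "vcycle xs" "set xs = pverts G"
proof -
  obtain v where "v \<in> pverts G" using assms(1) by fastforce
  then have "vpath [v]" by (simp add: vpath_def)
  then obtain xs where path: "vpath xs" and max: "\<And>ys. vpath ys \<Longrightarrow> length ys \<le> length xs"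
    using ex_has_greatest_nat[of vpath "[v]" length "Suc (card (pverts G))"] length_vpath_le
    by (metis le_imp_less_Suc)
  have ne: "xs \<noteq> []" and sub: "set xs \<subseteq> pverts G" and dist: "distinct xs"
    using path by (auto simp: vpath_def)
  have hd: "nbrs (hd xs) \<subseteq> set xs"
  proof
    fix y assume y: "y \<in> nbrs (hd xs)"
    show "y \<in> set xs"
    proof (rule ccontr)
      assume "y \<notin> set xs"
      then have "vpath (y # xs)"
        using y path by (auto simp: vpath_def successively_Cons adj_commute dest: in_arcsD1 in_arcsD2)
      then show False using max[of "y # xs"] by simp
    qed
  qed
  have snoc: "y \<in> set ys" if "vpath ys" "length ys = length xs" "adj (last ys) y" for ys y
  proof (rule ccontr)
    assume "y \<notin> set ys"
    then have "vpath (ys @ [y])"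
      using that by (auto simp: vpath_def successively_append_iff dest: in_arcsD2)
    then show False using max[of "ys @ [y]"] that by simp
  qed
  have last: "nbrs (last xs) \<subseteq> set xs" using snoc[OF path] by auto
  have V: "hd xs \<in> pverts G" "last xs \<in> pverts G" using ne sub by auto
  have big: "card (nbrs (hd xs)) < length xs"
  proof -
    have "nbrs (hd xs) \<subset> set xs" using hd ne nbrs_subset[of "hd xs"] hd_in_set[OF ne] by blast
    then show ?thesis using dist by (metis distinct_card List.finite_set psubset_card_mono)
  qed
  then have three: "3 \<le> length xs" using deg[OF V(1)] assms(1) by linarith
  have "length xs \<le> card (nbrs (hd xs)) + card (nbrs (last xs))"
    using deg[OF V(1)] deg[OF V(2)] length_vpath_le[OF path] by linarith
  from vcycle_of_long_path[OF path three this hd last]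
  obtain ys where ys: "vcycle ys" "set ys = set xs" "length ys = length xs" .
  have "set xs = pverts G"
  proof (rule ccontr)
    assume "set xs \<noteq> pverts G"
    then obtain w where w: "w \<in> pverts G" "w \<notin> set xs" using sub by auto
    have "nbrs w \<inter> set xs \<noteq> {}"
    proof
      assume "nbrs w \<inter> set xs = {}"
      then have "nbrs w \<subset> pverts G - set xs" using nbrs_subset[of w] w by blast
      then have "card (nbrs w) < card (pverts G - set xs)"
        by (intro psubset_card_mono) (simp add: pair_finite_verts)
      also have "\<dots> = card (pverts G) - length xs"
        using sub dist by (simp add: card_Diff_subset distinct_card)
      finally show False using deg[OF w(1)] deg[OF V(1)] big by linarith
    qed
    then obtain i where i: "i < length ys" "adj w (ys ! i)"
      using ys by (auto simp: in_set_conv_nth Image_iff) (metis in_set_conv_nth)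
    \<comment> \<open>The cycle is opened just after the neighbour of w, which becomes the last vertex.\<close>
    let ?zs = "rotate (Suc i) ys"
    have z: "vcycle ?zs" "length ?zs = length xs" "set ?zs = set xs"
      using ys vcycle_rotate by (auto simp del: rotate_Suc)
    have "last ?zs = ys ! i"
    proof -
      have "ys \<noteq> []" using i by auto
      then have "last ?zs = ys ! ((Suc i + (length ys - 1)) mod length ys)"
        by (simp add: last_conv_nth nth_rotate del: rotate_Suc)
      also have "Suc i + (length ys - 1) = i + length ys" using i by simp
      also have "\<dots> mod length ys = i" using i by simp
      finally show ?thesis .
    qed
    then have "w \<in> set ?zs"
      using snoc[of ?zs w] z i by (simp add: vcycle_def adj_commute del: rotate_Suc)
    then show False using w z by simp
  qed
  then show ?thesis using that ys by simp
qed

section \<open>Cycles missing one vertex\<close>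

text \<open>
  The vertex v off the cycle has at least half of all vertices as neighbours, which is more than
  half of the cycle.  So its set of neighbour positions meets every cyclic shift of itself, and
  two neighbours of v at distance k - 2 along the cycle give a cycle of length k.
\<close>

lemma pancyclic_of_almost_hamiltonian:
  assumes deg: "\<And>v. v \<in> pverts G \<Longrightarrow> card (pverts G) \<le> 2 * card (nbrs v)"
    and xs: "vcycle xs" "Suc (length xs) = card (pverts G)"
    and k: "3 \<le> k" "k \<le> card (pverts G)"
  shows "\<exists>ys. vcycle ys \<and> length ys = k"
proof -
  let ?L = "length xs"
  have dist: "distinct xs" and sub: "set xs \<subseteq> pverts G"
    using xs by (auto simp: vcycle_def vpath_def)
  have "card (pverts G - set xs) = 1"
    using dist sub xs by (simp add: card_Diff_subset distinct_card)
  then obtain v where v: "pverts G - set xs = {v}" by (auto simp: card_1_singleton_iff)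
  have "nbrs v \<subseteq> set xs" using nbrs_subset[of v] v by blast
  define A where "A = {i. i < ?L \<and> adj v (xs ! i)}"
  have A: "card A = card (nbrs v)"
    using card_nbr_positions[OF dist, of v] \<open>nbrs v \<subseteq> set xs\<close> by (simp add: A_def Int_absorb2)
  \<comment> \<open>A stretch of the cycle with k - 2 edges has k - 1 vertices; v is the k-th.\<close>
  let ?f = "\<lambda>i. (k - 2 + i) mod ?L"
  have L: "k - 2 < ?L" "0 < ?L" using k xs by auto
  have "inj_on ?f A"
  proof (rule inj_onI)
    fix i j assume "i \<in> A" "j \<in> A" "?f i = ?f j"
    then have "rotate (k - 2) xs ! i = rotate (k - 2) xs ! j" "i < ?L" "j < ?L"
      by (auto simp: nth_rotate A_def)
    then show "i = j" using dist by (simp add: nth_eq_iff_index_eq)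
  qed
  then have fA: "card (?f ` A) = card A" by (rule card_image)
  have "A \<inter> ?f ` A \<noteq> {}"
  proof
    assume "A \<inter> ?f ` A = {}"
    then have "card (A \<union> ?f ` A) = card A + card A"
      using fA by (subst card_Un_disjoint) (auto simp: A_def)
    moreover have "card (A \<union> ?f ` A) \<le> card {..<?L}"
      using L by (intro card_mono) (auto simp: A_def)
    ultimately show False using A deg[of v] v xs(2) by auto
  qed
  then obtain i where i: "i < ?L" "adj v (xs ! i)" "adj v (xs ! ?f i)"
    by (auto simp: A_def)
  let ?zs = "rotate i xs"
  have z: "vcycle ?zs" "length ?zs = ?L" "set ?zs = set xs" using xs vcycle_rotate by auto
  have z0: "hd ?zs = xs ! i" using i L by (subst hd_rotate_conv_nth) auto
  have zk: "?zs ! (k - 2) = xs ! ?f i" using L by (simp add: nth_rotate add.commute)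
  let ?ys = "take (Suc (k - 2)) ?zs"
  have "last ?ys = xs ! ?f i"
    using zk L z(2) by (simp add: take_Suc_conv_app_nth)
  moreover have "hd ?ys = xs ! i" using z0 L by (simp add: take_Suc)
  moreover have "?ys \<noteq> []" "length ?ys = k - 1" using k L by auto
  moreover have "successively adj ?ys"
    using z(1) by (metis append_take_drop_id successively_append_iff vcycle_def vpath_def)
  moreover have "set ?ys \<subseteq> set xs" using z(3) set_take_subset by metis
  ultimately have "vcycle (v # ?ys)" "length (v # ?ys) = k"
    using i k v sub dist by (auto simp: vcycle_def vpath_def successively_Cons adj_commute)
  then show ?thesis by blast
qed

section \<open>Regular graphs without a cycle missing one vertex\<close>

lemma vcycle_skip_vertex:
  assumes "vcycle (a # b # c # xs)" "xs \<noteq> []" "adj a c"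
  shows "vcycle (a # c # xs)"
  using assms by (cases xs) (auto simp: vcycle_def vpath_def successively_Cons)

text \<open>
  The two chords leave from consecutive vertices a and hd P of the cycle and enclose b: run along
  P, jump from its end to a, go backwards through Q, and return from hd Q to hd P.
\<close>

lemma vcycle_crossing_chords:
  assumes "vcycle (a # P @ b # Q)" "P \<noteq> []" "Q \<noteq> []" "adj a (last P)" "adj (hd P) (hd Q)"
  shows "vcycle (P @ a # rev Q)"
proof -
  have *: "successively adj P" "successively adj Q" "adj (last Q) a"
    using assms
    by (simp_all add: vcycle_def vpath_def successively_append_iff successively_Cons)
  show ?thesis
    unfolding vcycle_def vpath_def
  proof (intro conjI)
    show "3 \<le> length (P @ a # rev Q)"
      using assms(2,3) by (cases P; cases Q) auto
    show "P @ a # rev Q \<noteq> []" by simp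
    show "set (P @ a # rev Q) \<subseteq> pverts G" "distinct (P @ a # rev Q)"
      using assms(1) by (auto simp: vcycle_def vpath_def)
    have "successively adj (rev Q)" using * by (simp only: successively_adj_rev)
    moreover have "adj (last P) a" "adj a (last Q)" "adj (hd Q) (hd P)"
      using assms * adj_commute by blast+
    ultimately show "successively adj (P @ a # rev Q)" "adj (last (P @ a # rev Q)) (hd (P @ a # rev Q))"
      using * assms(2,3)
      by (simp_all add: successively_append_iff successively_Cons hd_rev last_rev)
  qed
qed

end

text \<open>
  The extremal situation.  It is shown below that such a graph is complete bipartite as soon as it
  has a Hamiltonian cycle.
\<close>

locale no_almost_hamiltonian = pair_graph +
  fixes n :: nat
  assumes n: "2 \<le> n" and order: "card (pverts G) = 2 * n"
    and regular: "v \<in> pverts G \<Longrightarrow> card (parcs G `` {v}) = n"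
    and no_cycle: "vcycle xs \<Longrightarrow> Suc (length xs) \<noteq> 2 * n"
begin

definition hamiltonian :: "'a list \<Rightarrow> bool" where
  "hamiltonian xs \<longleftrightarrow> vcycle xs \<and> set xs = pverts G"

lemma length_hamiltonian: "hamiltonian xs \<Longrightarrow> length xs = 2 * n"
  using order by (metis hamiltonian_def vcycle_def vpath_def distinct_card)

lemma hamiltonian_rotate: "hamiltonian xs \<Longrightarrow> hamiltonian (rotate k xs)"
  by (simp add: hamiltonian_def vcycle_rotate)

lemma hamiltonian_adj_next:
  assumes "hamiltonian xs"
  shows "adj (xs ! 0) (xs ! 1)" "adj (xs ! 0) (xs ! (2 * n - 1))"
proof -
  obtain a b zs where xs: "xs = a # b # zs"
    using length_hamiltonian[OF assms] n by (cases xs rule: remdups_adj.cases) auto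
  then show "adj (xs ! 0) (xs ! 1)"
    using assms by (simp add: hamiltonian_def vcycle_def vpath_def)
  have "last xs = xs ! (2 * n - 1)" 
    using length_hamiltonian[OF assms] xs by (metis last_conv_nth list.distinct(1))
  then show "adj (xs ! 0) (xs ! (2 * n - 1))"
    using assms xs by (simp add: hamiltonian_def vcycle_def adj_commute)
qed

lemma hamiltonian_not_adj_2:
  assumes "hamiltonian xs"
  shows "\<not> adj (xs ! 0) (xs ! 2)"
proof
  assume adj: "adj (xs ! 0) (xs ! 2)"
  have len: "length xs = 2 * n" using length_hamiltonian[OF assms] .
  obtain a b c zs where xs: "xs = a # b # c # zs" "zs \<noteq> []"
  proof -
    have "length xs = Suc (Suc (Suc (Suc (2 * n - 4))))" using len n by simp
    then show ?thesis using that by (auto simp: length_Suc_conv)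
  qed
  then have "vcycle (a # b # c # zs)" "adj a c" using assms adj by (simp_all add: hamiltonian_def)
  with xs(2) have "vcycle (a # c # zs)" using vcycle_skip_vertex by blast
  then show False using no_cycle[of "a # c # zs"] len xs by simp
qed

lemma hamiltonian_not_crossing:
  assumes "hamiltonian xs" "2 \<le> t" "t \<le> 2 * n - 3"
    and "adj (xs ! 0) (xs ! t)" "adj (xs ! 1) (xs ! (t + 2))"
  shows False
proof -
  have len: "length xs = 2 * n" using length_hamiltonian[OF assms(1)] .
  define P where "P = take t (tl xs)"
  define Q where "Q = drop (t + 2) xs"
  have t: "t + 2 < length xs" using len assms n by linarith
  have PQ: "length P = t" "length Q = 2 * n - t - 2" using len t by (simp_all add: P_def Q_def)
  have ne: "P \<noteq> []" "Q \<noteq> []" using PQ t assms len by auto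
  have xs: "xs = xs ! 0 # P @ xs ! (t + 1) # Q"
  proof -
    have "tl xs = P @ drop t (tl xs)" by (simp add: P_def)
    also have "drop t (tl xs) = drop (t + 1) xs" by (simp add: drop_Suc)
    also have "\<dots> = xs ! (t + 1) # Q"
      using t by (simp add: Q_def Cons_nth_drop_Suc[symmetric])
    finally show ?thesis using len n by (cases xs) auto
  qed
  have "hd P = xs ! 1" "last P = xs ! t" "hd Q = xs ! (t + 2)"
    using t assms(2) ne PQ
    by (auto simp: hd_conv_nth last_conv_nth P_def Q_def nth_tl)
  then have "adj (xs ! 0) (last P)" "adj (hd P) (hd Q)" using assms(4,5) by simp_all
  moreover have "vcycle (xs ! 0 # P @ xs ! (t + 1) # Q)"
    using assms(1) xs unfolding hamiltonian_def by metis
  ultimately have "vcycle (P @ xs ! 0 # rev Q)" using ne vcycle_crossing_chords by blast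
  then show False using no_cycle PQ t len by fastforce
qed

text \<open>
  Regularity makes the bound coming from crossing chords tight.  The positions t from 2 to
  2n - 3 are 2n - 4 in number; apart from its two neighbours on the cycle, each of the vertices
  at positions 0 and 1 has n - 2 neighbours, counted at t and t + 2 respectively.
  The two sets of values t are disjoint, hence complementary.
\<close>

lemma hamiltonian_alternate:
  assumes xs: "hamiltonian xs" and t: "2 \<le> t" "t \<le> 2 * n - 3"
  shows "adj (xs ! 1) (xs ! (t + 2)) \<longleftrightarrow> \<not> adj (xs ! 0) (xs ! t)"
proof -
  have len: "length xs = 2 * n" using length_hamiltonian[OF xs] .
  have dist: "distinct xs" and set: "set xs = pverts G"
    using xs by (auto simp: hamiltonian_def vcycle_def vpath_def)
  let ?I = "{2..2 * n - 3}"
  define A where "A = {t \<in> ?I. adj (xs ! 0) (xs ! t)}"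
  define B where "B = {t \<in> ?I. adj (xs ! 1) (xs ! (t + 2))}"
  have deg: "card {i. i < 2 * n \<and> adj (xs ! j) (xs ! i)} = n" if "j < 2 * n" for j
  proof -
    have "xs ! j \<in> pverts G" using that len set by force
    moreover have "nbrs (xs ! j) \<inter> set xs = nbrs (xs ! j)" using set nbrs_subset by blast
    ultimately show ?thesis
      using card_nbr_positions[OF dist, of "xs ! j"] regular len by simp
  qed
  \<comment> \<open>The positions outside the range of t and t + 2 are decided by the edges of the cycle and by
    skipping a vertex, after rotating the cycle.\<close>
  have rot: "rotate 1 xs ! j = xs ! Suc j" if "Suc j < 2 * n" for j
    using that len by (simp add: nth_rotate1)
  have "\<not> adj (xs ! 1) (xs ! 3)"
    using hamiltonian_not_adj_2[OF hamiltonian_rotate[OF xs, of 1]] rot[of 0] rot[of 2] n by simp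
  moreover have "\<not> adj (xs ! 0) (xs ! (2 * n - 2))"
  proof -
    have "2 * n - 2 + 2 = 2 * n" using n by linarith
    then have "(2 * n - 2 + 2) mod (2 * n) = 0" by (metis mod_self)
    then show ?thesis
      using hamiltonian_not_adj_2[OF hamiltonian_rotate[OF xs, of "2 * n - 2"]] len n
      by (simp add: nth_rotate adj_commute del: add_2_eq_Suc')
  qed
  moreover have "adj (xs ! 0) (xs ! 1)" "adj (xs ! 0) (xs ! (2 * n - 1))"
    using hamiltonian_adj_next[OF xs] .
  moreover have "adj (xs ! 1) (xs ! 2)"
    using hamiltonian_adj_next(1)[OF hamiltonian_rotate[OF xs, of 1]] rot[of 0] rot[of 1] n
    by (simp add: numeral_2_eq_2)
  moreover have "\<not> adj v v" for v using no_loops' by blast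
  ultimately have nb: "\<not> adj (xs ! 1) (xs ! 3)" "\<not> adj (xs ! 0) (xs ! (2 * n - 2))"
     "adj (xs ! 0) (xs ! 1)" "adj (xs ! 0) (xs ! (2 * n - 1))" "adj (xs ! 1) (xs ! 2)"
     "adj (xs ! 1) (xs ! 0)" "\<not> adj (xs ! 0) (xs ! 0)" "\<not> adj (xs ! 1) (xs ! 1)"
    by (auto simp: adj_commute)
  have finA: "finite A" "finite B" by (auto simp: A_def B_def)
  have "{i. i < 2 * n \<and> adj (xs ! 0) (xs ! i)} = insert 1 (insert (2 * n - 1) A)"
  proof (intro set_eqI)
    fix i
    consider "i = 0" | "i = 1" | "i = 2 * n - 2" | "i = 2 * n - 1" | "2 * n \<le> i" | "i \<in> ?I"
      using n by force
    then show "i \<in> {i. i < 2 * n \<and> adj (xs ! 0) (xs ! i)} \<longleftrightarrow>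
        i \<in> insert 1 (insert (2 * n - 1) A)"
      by cases (use nb n in \<open>auto simp: A_def\<close>)
  qed
  moreover have "1 \<notin> insert (2 * n - 1) A" "2 * n - 1 \<notin> A" using n by (auto simp: A_def)
  ultimately have A: "card A = n - 2" using deg[of 0] n finA by simp
  have "{i. i < 2 * n \<and> adj (xs ! 1) (xs ! i)} = insert 0 (insert 2 ((\<lambda>t. t + 2) ` B))"
  proof (intro set_eqI)
    fix i
    consider "i = 0" | "i = 1" | "i = 2" | "i = 3" | "2 * n \<le> i" | "i - 2 \<in> ?I" "i = (i - 2) + 2"
      using n by force
    then show "i \<in> {i. i < 2 * n \<and> adj (xs ! 1) (xs ! i)} \<longleftrightarrow>
        i \<in> insert 0 (insert 2 ((\<lambda>t. t + 2) ` B))"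
    proof cases
      case 6
      then show ?thesis
        using n by (auto simp: B_def image_iff)
    qed (use nb n in \<open>auto simp: B_def\<close>)
  qed
  moreover have "0 \<notin> insert 2 ((\<lambda>t. t + 2) ` B)" "2 \<notin> (\<lambda>t. t + 2) ` B" by (auto simp: B_def)
  moreover have "card ((\<lambda>t. t + 2) ` B) = card B" by (intro card_image inj_onI) simp
  ultimately have B: "card B = n - 2" using deg[of 1] n finA by simp
  have "A \<inter> B = {}" using hamiltonian_not_crossing[OF xs] by (auto simp: A_def B_def)
  then have "card (A \<union> B) = card ?I" using A B finA n by (simp add: card_Un_disjoint)
  then have "A \<union> B = ?I" by (intro card_subset_eq) (auto simp: A_def B_def)
  then show ?thesis using \<open>A \<inter> B = {}\<close> t unfolding A_def B_def by auto
qed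

text \<open>
  Induction on the distance, for all Hamiltonian cycles at once: alternation relates the distance
  s measured from one vertex to the distance s - 1 measured from its predecessor, that is, on a
  rotation of the cycle.
\<close>

lemma adj_hd_iff_odd:
  assumes "hamiltonian xs" "1 \<le> s" "s < 2 * n"
  shows "adj (xs ! 0) (xs ! s) \<longleftrightarrow> odd s"
  using assms
proof (induction s arbitrary: xs rule: less_induct)
  case (less s)
  have len: "length xs = 2 * n" using length_hamiltonian[OF less.prems(1)] .
  consider "s = 1" | "s = 2" | "s = 2 * n - 1" | "3 \<le> s" "s \<le> 2 * n - 2"
    using less.prems by linarith
  then show ?case
  proof cases
    case 4
    \<comment> \<open>The rotation by one step backwards.\<close>
    define zs where "zs = rotate (2 * n - 1) xs"
    have zs: "hamiltonian zs" using less.prems(1) by (simp add: zs_def hamiltonian_rotate)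
    have nth: "zs ! Suc j = xs ! j" if "Suc j < 2 * n" for j
      using that len by (simp add: zs_def nth_rotate)
    have "adj (xs ! 0) (xs ! s) \<longleftrightarrow> adj (zs ! 1) (zs ! (s - 1 + 2))"
      using 4 n nth[of 0] nth[of s] by simp
    also have "\<dots> \<longleftrightarrow> \<not> adj (zs ! 0) (zs ! (s - 1))"
      using 4 by (intro hamiltonian_alternate[OF zs]) auto
    also have "adj (zs ! 0) (zs ! (s - 1)) \<longleftrightarrow> odd (s - 1)"
      using 4 by (intro less.IH[OF _ zs]) auto
    finally show ?thesis using 4 by simp
  qed (use less.prems hamiltonian_adj_next hamiltonian_not_adj_2 n in auto)
qed

lemma adj_nth_iff_odd:
  assumes "hamiltonian xs" "i < 2 * n" "j < 2 * n"
  shows "adj (xs ! i) (xs ! j) \<longleftrightarrow> odd (i + j)"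
proof -
  have len: "length xs = 2 * n" using length_hamiltonian[OF assms(1)] .
  have *: "adj (xs ! i) (xs ! j) \<longleftrightarrow> odd (i + j)" if "i < j" "j < 2 * n" for i j
  proof -
    have "adj (rotate i xs ! 0) (rotate i xs ! (j - i)) \<longleftrightarrow> odd (j - i)"
      using that by (intro adj_hd_iff_odd hamiltonian_rotate assms) auto
    then show ?thesis using that len by (auto simp: nth_rotate)
  qed
  show ?thesis
  proof (cases i j rule: linorder_cases)
    case equal
    then show ?thesis using no_loops' by auto
  next
    case greater
    then show ?thesis
      using *[OF greater assms(2)] adj_commute[of "xs ! i"] by (simp add: add.commute)
  qed (use * assms in auto)
qed

end

section \<open>Degree sequences and isomorphism with two cliques\<close>

lemma out_degree_with_proj: "out_degree (with_proj G) v = card (parcs G `` {v})"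
proof -
  have "out_arcs (with_proj G) v = Pair v ` (parcs G `` {v})"
    by (auto simp: out_arcs_def)
  then show ?thesis by (simp add: out_degree_def card_image inj_on_def)
qed

lemma digraph_iso_with_projI:
  assumes "pair_wf_digraph G" "pair_wf_digraph H"
    and bij: "bij_betw f (pverts G) (pverts H)"
    and arcs: "\<And>u v. u \<in> pverts G \<Longrightarrow> v \<in> pverts G \<Longrightarrow>
      (u, v) \<in> parcs G \<longleftrightarrow> (f u, f v) \<in> parcs H"
  shows "digraph_iso (with_proj G) (with_proj H)"
proof -
  interpret G: pair_wf_digraph G by fact
  interpret H: pair_wf_digraph H by fact
  let ?h = "\<lparr>iso_verts = f, iso_arcs = map_prod f f, iso_head = snd, iso_tail = fst\<rparr>"
  have im: "f ` pverts G = pverts H" and inj: "inj_on f (pverts G)"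
    using bij by (auto simp: bij_betw_def)
  have "parcs G \<subseteq> pverts G \<times> pverts G" by (auto dest: G.in_arcsD1 G.in_arcsD2)
  then have "inj_on (map_prod f f) (parcs G)"
    using map_prod_inj_on[OF inj inj] inj_on_subset by blast
  then have "G.digraph_isomorphism ?h"
    using inj by (auto simp: G.digraph_isomorphism_def intro: G.wf_digraph_axioms)
  moreover have "map_prod f f ` parcs G = parcs H"
  proof (intro equalityI subsetI)
    fix e assume "e \<in> parcs H"
    moreover obtain x y where e: "e = (x, y)" by fastforce
    ultimately have "x \<in> f ` pverts G" "y \<in> f ` pverts G"
      using im by (auto dest: H.in_arcsD1 H.in_arcsD2)
    then obtain u v where uv: "u \<in> pverts G" "v \<in> pverts G" "e = (f u, f v)" using e by auto
    with \<open>e \<in> parcs H\<close> arcs have "(u, v) \<in> parcs G" by simp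
    then show "e \<in> map_prod f f ` parcs G" using uv by force
  qed (auto simp: arcs[symmetric] G.in_arcsD1 G.in_arcsD2)
  ultimately show ?thesis
    using im unfolding digraph_iso_def
    by (intro exI[of _ ?h]) (auto simp: app_iso_def with_proj_def)
qed

lemma pverts_two_cliques: "pverts (two_cliques n) = {..<n} <+> {..<n}"
  by (simp add: two_cliques_def graph_disjoint_union_def complete_graph_def)

lemma in_parcs_two_cliques:
  "(Inl i, Inl j) \<in> parcs (two_cliques n) \<longleftrightarrow> i < n \<and> j < n \<and> i \<noteq> j"
  "(Inr i, Inr j) \<in> parcs (two_cliques n) \<longleftrightarrow> i < n \<and> j < n \<and> i \<noteq> j"
  "(Inl i, Inr j) \<notin> parcs (two_cliques n)"
  "(Inr i, Inl j) \<notin> parcs (two_cliques n)"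
  by (auto simp: two_cliques_def graph_disjoint_union_def complete_graph_def)

lemma out_degree_two_cliques:
  assumes "v \<in> pverts (two_cliques n)"
  shows "out_degree (with_proj (two_cliques n)) v = n - 1"
proof (cases v)
  case (Inl i)
  have "parcs (two_cliques n) `` {Inl i} = Inl ` ({..<n} - {i})"
  proof (intro set_eqI)
    fix w show "w \<in> parcs (two_cliques n) `` {Inl i} \<longleftrightarrow> w \<in> Inl ` ({..<n} - {i})"
      using assms Inl by (cases w) (auto simp: in_parcs_two_cliques pverts_two_cliques)
  qed
  then show ?thesis
    using assms Inl by (auto simp: out_degree_with_proj card_image pverts_two_cliques)
next
  case (Inr i)
  have "parcs (two_cliques n) `` {Inr i} = Inr ` ({..<n} - {i})"
  proof (intro set_eqI)
    fix w show "w \<in> parcs (two_cliques n) `` {Inr i} \<longleftrightarrow> w \<in> Inr ` ({..<n} - {i})"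
      using assms Inr by (cases w) (auto simp: in_parcs_two_cliques pverts_two_cliques)
  qed
  then show ?thesis
    using assms Inr by (auto simp: out_degree_with_proj card_image pverts_two_cliques)
qed

text \<open>
  The degree sequence determines the multiset of degrees, and here all of them are n - 1.
\<close>

lemma regular_of_degree_sequence_two_cliques:
  assumes "finite (pverts G)" and eq: "degree_sequence G = degree_sequence (two_cliques n)"
  shows "card (pverts G) = 2 * n"
    and "v \<in> pverts G \<Longrightarrow> out_degree (with_proj G) v = n - 1"
proof -
  let ?M = "\<lambda>G. image_mset (out_degree (with_proj G)) (mset_set (pverts G))"
  have M: "?M G = ?M (two_cliques n)"
    using eq unfolding degree_sequence_def
    by (metis mset_sorted_list_of_multiset rev_is_rev_conv)
  have fin: "finite (pverts (two_cliques n))" by (simp add: pverts_two_cliques)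
  have "size (?M G) = size (?M (two_cliques n))" using M by simp
  then show "card (pverts G) = 2 * n" by (simp add: pverts_two_cliques card_Plus)
  assume "v \<in> pverts G"
  then have "out_degree (with_proj G) v \<in># ?M G" using assms(1) by simp
  then show "out_degree (with_proj G) v = n - 1"
    unfolding M using fin by (auto simp: out_degree_two_cliques)
qed

lemma card_nbrs_graph_complement:
  assumes "pair_graph G" "v \<in> pverts G"
  shows "card (parcs (graph_complement G) `` {v}) =
    card (pverts G) - 1 - out_degree (with_proj G) v"
proof -
  interpret pair_graph G by fact
  have "parcs (graph_complement G) `` {v} = (pverts G - {v}) - nbrs v"
    using assms(2) by (auto simp: graph_complement_def)
  then show ?thesis
    using assms(2) nbrs_subset[of v] finite_nbrs pair_finite_verts
    by (simp add: card_Diff_subset out_degree_with_proj)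
qed

text \<open>
  The even positions of the list are mapped to one clique and the odd positions to the other one.
\<close>

lemma iso_two_cliques:
  assumes G: "pair_graph G" and "distinct xs" "set xs = pverts G" "length xs = 2 * n"
    and arcs: "\<And>i j. i < 2 * n \<Longrightarrow> j < 2 * n \<Longrightarrow>
      (xs ! i, xs ! j) \<in> parcs G \<longleftrightarrow> i \<noteq> j \<and> even (i + j)"
  shows "digraph_iso (with_proj G) (with_proj (two_cliques n))"
proof -
  define h where "h i = (if even i then Inl (i div 2) else Inr (i div 2) :: nat + nat)" for i :: nat
  have bij_xs: "bij_betw ((!) xs) {..<2 * n} (pverts G)"
    using assms bij_betw_nth by metis
  have bij_h: "bij_betw h {..<2 * n} (pverts (two_cliques n))"
  proof (intro bij_betwI[where g = "case_sum (\<lambda>i. 2 * i) (\<lambda>i. 2 * i + 1)"])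
    show "h \<in> {..<2 * n} \<rightarrow> pverts (two_cliques n)" by (auto simp: h_def pverts_two_cliques)
  qed (auto simp: h_def pverts_two_cliques split: sum.splits)
  define f where "f = h \<circ> the_inv_into {..<2 * n} ((!) xs)"
  have f: "f (xs ! i) = h i" if "i < 2 * n" for i
    using that bij_xs by (simp add: f_def the_inv_into_f_f bij_betw_def)
  have h: "(h i, h j) \<in> parcs (two_cliques n) \<longleftrightarrow> i \<noteq> j \<and> even (i + j)"
    if "i < 2 * n" "j < 2 * n" for i j
    using that by (auto simp: h_def in_parcs_two_cliques elim!: evenE oddE)
  show ?thesis
  proof (rule digraph_iso_with_projI)
    show "pair_wf_digraph G" using G by (simp add: pair_graph_def pair_digraph_def pair_fin_digraph_def)
    show "pair_wf_digraph (two_cliques n)"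
      using pair_graph_two_cliques by (simp add: pair_graph_def pair_digraph_def pair_fin_digraph_def)
    show "bij_betw f (pverts G) (pverts (two_cliques n))"
      unfolding f_def using bij_betw_trans[OF bij_betw_the_inv_into[OF bij_xs] bij_h] .
    fix u v assume "u \<in> pverts G" "v \<in> pverts G"
    then obtain i j where "u = xs ! i" "v = xs ! j" "i < 2 * n" "j < 2 * n"
      using assms by (metis in_set_conv_nth)
    then show "(u, v) \<in> parcs G \<longleftrightarrow> (f u, f v) \<in> parcs (two_cliques n)"
      using f h arcs by simp
  qed
qed

section \<open>Pancyclicity\<close>

theorem proposition7:
  fixes n :: nat and G :: "'a pair_pre_digraph"
  assumes "n > 0"
    and "G \<in> co_two_cliques_class n"
  shows "pancyclic G"
proof -
  obtain H where H: "pair_graph H" "degree_sequence H = degree_sequence (two_cliques n)"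
    "\<not> digraph_iso (with_proj H) (with_proj (two_cliques n))" and G: "G = graph_complement H"
    using assms(2) by (auto simp: co_two_cliques_class_def two_cliques_class_def)
  interpret G: pair_graph G unfolding G using H(1) by (rule pair_graph_graph_complement)
  interpret H: pair_graph H by fact
  have V: "pverts G = pverts H" by (simp add: G graph_complement_def)
  note H_regular = regular_of_degree_sequence_two_cliques[OF H.pair_finite_verts H(2)]
  have order: "card (pverts G) = 2 * n" using H_regular V by simp
  have regular: "card (G.nbrs v) = n" if "v \<in> pverts G" for v
    using that card_nbrs_graph_complement[OF H(1), of v] H_regular V assms(1) by (simp add: G)
  show ?thesis
    unfolding pancyclic_def
  proof
    fix k assume k: "k \<in> {3..card (pverts G)}"
    then have n: "2 \<le> n" using order by auto
    have deg: "card (pverts G) \<le> 2 * card (G.nbrs v)" if "v \<in> pverts G" for v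
      using order regular[OF that] by simp
    obtain xs where xs: "G.vcycle xs" "set xs = pverts G"
      using G.dirac[OF _ deg] n order by auto
    have "\<exists>ys. G.vcycle ys \<and> Suc (length ys) = 2 * n"
    proof (rule ccontr)
      assume "\<nexists>ys. G.vcycle ys \<and> Suc (length ys) = 2 * n"
      then interpret no_almost_hamiltonian G n
        using n order regular by unfold_locales auto
      have ham: "hamiltonian xs" using xs by (simp add: hamiltonian_def)
      have "digraph_iso (with_proj H) (with_proj (two_cliques n))"
      proof (rule iso_two_cliques[OF H(1)])
        show d: "distinct xs" using xs by (simp add: G.vcycle_def G.vpath_def)
        show "set xs = pverts H" using xs V by simp
        show l: "length xs = 2 * n" using length_hamiltonian[OF ham] .
        fix i j assume ij: "i < 2 * n" "j < 2 * n"
        then have "xs ! i \<in> pverts H" "xs ! j \<in> pverts H" using l xs V by auto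
        moreover have "xs ! i = xs ! j \<longleftrightarrow> i = j" using d l ij by (simp add: nth_eq_iff_index_eq)
        ultimately have "(xs ! i, xs ! j) \<in> parcs H \<longleftrightarrow> i \<noteq> j \<and> \<not> G.adj (xs ! i) (xs ! j)"
          using H.no_loops' by (auto simp: G graph_complement_def)
        then show "(xs ! i, xs ! j) \<in> parcs H \<longleftrightarrow> i \<noteq> j \<and> even (i + j)"
          using adj_nth_iff_odd[OF ham ij] by simp
      qed
      with H(3) show False by simp
    qed
    then obtain ys where "G.vcycle ys" "length ys = k"
      using G.pancyclic_of_almost_hamiltonian[OF deg] order k by force
    then show "\<exists>p. G.cycle p \<and> length p = k"
      using G.cycle_of_vcycle by blast
  qed
qed

end
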